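(* Let $n\geq 2$ be an even integer, let $M_1,M_2\in\mathbb{R}^{n\times n}$ be skew-symmetric matrices and $q_1,q_2\in\mathbb{R}^n$. Consider the unconstrained bicriteria affine vector variational inequality $(\mathrm{AVVI})$ defined by the operators $F_i(x)=M_ix+q_i$ ($i=1,2$) and the constraint set $K=\mathbb{R}^n$. If $(\mathrm{AVVI})$ is nondegenerate, then $$\max\left\{\chi(\mathrm{Sol}(\mathrm{AVVI})),\ \chi(\mathrm{Sol}^w(\mathrm{AVVI}))\right\}\leq n+1.$$
   Context: An affine vector variational inequality $(\mathrm{AVVI})$ with $n$ variables and $m$ criteria is given by a nonempty polyhedral convex set $K\subset\mathbb{R}^n$ and affine operators $F_i(x)=M_ix+q_i$, $i=1,\dots,m$, with $M_i\in\mathbb{R}^{n\times n}$, $q_i\in\mathbb{R}^n$. For $x\in K$, $u\in\mathbb{R}^n$ put $F(x)(u)=(\langle F_1(x),u\rangle,\dots,\langle F_m(x),u\rangle)\in\mathbb{R}^m$, and let $C=\mathbb{R}^m_+$ be the nonnegative orthant. The Pareto solution set $\mathrm{Sol}(\mathrm{AVVI})$ is the set of $x\in K$ such that $F(x)(x-y)\notin C\setminus\{0\}$ for all $y\in K$. The weak Pareto solution set $\mathrm{Sol}^w(\mathrm{AVVI})$ is the set of $x\in K$ such that $F(x)(x-y)\notin \mathrm{int}\,C$ for all $y\in K$. The problem is bicriteria if $m=2$, unconstrained if $K=\mathbb{R}^n$, and skew-symmetric if $M_i^T=-M_i$ for all $i$. It is nondegenerate if there exists $\xi\in\Delta_m=\{\xi\in\mathbb{R}^m_+:\sum_{l=1}^m\xi_l=1\}$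 with $\det\left(\sum_{i=1}^m\xi_iM_i\right)\neq 0$. For a topological space $S$ (here a subset of $\mathbb{R}^n$ with the induced topology), $\chi(S)$ denotes the number (cardinality of the set) of connected components of $S$; the empty set has no connected components. *)

theory Defs
  imports "HOL-Analysis.Analysis"
begin

text \<open>The \<open>m\<close> criteria are indexed by a finite type \<open>'m\<close>, the \<open>n\<close> variables by a finite type \<open>'n\<close>.\<close>

definition affine_op :: "real^'n^'n \<Rightarrow> real^'n \<Rightarrow> real^'n \<Rightarrow> real^'n" where
  "affine_op A b x = A *v x + b"

definition vector_op ::
  "('m::finite \<Rightarrow> real^'n^'n) \<Rightarrow> ('m \<Rightarrow> real^'n) \<Rightarrow> real^'n \<Rightarrow> real^'n \<Rightarrow> real^'m" where
  "vector_op M q x u = (\<chi> i. affine_op (M i) (q i) x \<bullet> u)"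

definition nonneg_orthant :: "(real^'m::finite) set" where
  "nonneg_orthant = {z. \<forall>i. 0 \<le> z $ i}"

definition Sol ::
  "(real^'n) set \<Rightarrow> ('m::finite \<Rightarrow> real^'n^'n) \<Rightarrow> ('m \<Rightarrow> real^'n) \<Rightarrow> (real^'n) set" where
  "Sol K M q = {x \<in> K. \<forall>y\<in>K. vector_op M q x (x - y) \<notin> nonneg_orthant - {0}}"

definition Sol_weak ::
  "(real^'n) set \<Rightarrow> ('m::finite \<Rightarrow> real^'n^'n) \<Rightarrow> ('m \<Rightarrow> real^'n) \<Rightarrow> (real^'n) set" where
  "Sol_weak K M q = {x \<in> K. \<forall>y\<in>K. vector_op M q x (x - y) \<notin> interior nonneg_orthant}"

definition skew_symmetric :: "real^'n^'n \<Rightarrow> bool" where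
  "skew_symmetric A \<longleftrightarrow> transpose A = - A"

definition unit_simplex :: "(real^'m::finite) set" where
  "unit_simplex = {\<xi> \<in> nonneg_orthant. (\<Sum>l\<in>UNIV. \<xi> $ l) = 1}"

definition nondegenerate :: "('m::finite \<Rightarrow> real^'n^'n) \<Rightarrow> bool" where
  "nondegenerate M \<longleftrightarrow> (\<exists>\<xi>\<in>unit_simplex. det (\<Sum>i\<in>UNIV. \<xi> $ i *\<^sub>R M i) \<noteq> 0)"

text \<open>
  The number of connected components takes values in \<^typ>\<open>enat\<close>, because \<^const>\<open>card\<close>
  is \<open>0\<close> on infinite sets. An upper bound by a natural number thus includes finiteness.
\<close>

definition num_components :: "'a::topological_space set \<Rightarrow> enat" where
  "num_components S = (if finite (components S) then enat (card (components S)) else \<infinity>)"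

end

theory Submission
  imports Defs
begin

text \<open>
  By the theorems of Gordan and Stiemke, the weak Pareto and the Pareto solutions are the solutions
  of the linear systems \<open>M(t) x = - q(t)\<close> with \<open>M(t) = (1 - t) M\<^sub>1 + t M\<^sub>2\<close> and
  \<open>q(t) = (1 - t) q\<^sub>1 + t q\<^sub>2\<close>, where \<open>t\<close> ranges over \<open>[0,1]\<close> and \<open>(0,1)\<close> respectively.
  The determinant of a real skew-symmetric matrix is nonnegative, so every real root of the nonzero
  polynomial \<open>det M(t)\<close> is at least double, and there are \<open>k \<le> n/2\<close> distinct ones (this replaces
  the Pfaffian). They cut the parameter interval into at most \<open>k + 1\<close> pieces, on each of which the
  unique solution depends continuously on \<open>t\<close>; each root contributes one more connected set, an
  affine subspace or the empty set. Hence there are at most \<open>2k + 1 \<le> n + 1\<close> components.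
\<close>

section \<open>Counting components through connected covers\<close>

lemma card_components_le_cover:
  fixes S :: "'a::topological_space set"
  assumes fin: "finite \<C>" and con: "\<And>C. C \<in> \<C> \<Longrightarrow> connected C" and cov: "\<Union>\<C> = S"
  shows "finite (components S)" and "card (components S) \<le> card \<C>"
proof -
  \<comment> \<open>A cover member through a point of \<open>C\<close> is connected, so it stays
    inside \<open>C\<close> by maximality. Distinct components are disjoint, hence they choose
    distinct nonempty members.\<close>
  have "\<exists>D\<in>\<C>. D \<subseteq> C \<and> D \<noteq> {}" if C: "C \<in> components S" for C
  proof -
    obtain x where x: "x \<in> C" using C in_components_nonempty by fastforce
    then have "x \<in> S" using C in_components_subset by blast
    then obtain D where D: "D \<in> \<C>" "x \<in> D" using cov by blast
    then have "D \<subseteq> C"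
      using components_maximal[OF C con[OF D(1)]] x cov by blast
    then show ?thesis using D by blast
  qed
  then obtain f where f: "\<And>C. C \<in> components S \<Longrightarrow> f C \<in> \<C> \<and> f C \<subseteq> C \<and> f C \<noteq> {}"
    by metis
  have inj: "inj_on f (components S)"
  proof (rule inj_onI)
    fix C D assume CD: "C \<in> components S" "D \<in> components S" "f C = f D"
    then have "f C \<subseteq> C \<inter> D" "f C \<noteq> {}" using f[of C] f[of D] by auto
    then have "C \<inter> D \<noteq> {}" by blast
    then show "C = D" using components_nonoverlap[OF CD(1,2)] by simp
  qed
  have im: "f ` components S \<subseteq> \<C>" using f by blast
  show "finite (components S)" using inj im fin by (metis finite_imageD finite_subset)
  show "card (components S) \<le> card \<C>" using card_inj_on_le[OF inj im fin] .
qed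

lemma interval_minus_finite_cover:
  fixes I R :: "real set"
  assumes I: "is_interval I" and R: "finite R"
  obtains J where "\<And>j. connected (J j)" and "(\<Union>j\<le>card R. J j) = I - R"
proof
  \<comment> \<open>Points are grouped by how many elements of \<open>R\<close> lie to their left.
    The counts run from 0 to \<open>card R\<close>, whence \<open>card R + 1\<close> pieces; some of
    them may be empty.\<close>
  define J where "J j = {t \<in> I - R. card {r\<in>R. r < t} = j}" for j
  show "connected (J j)" for j
  proof -
    have "u \<in> J j" if "s \<in> J j" "t \<in> J j" "s \<le> u" "u \<le> t" for s t u
    proof -
      have fin: "finite {r\<in>R. r < v}" for v using R by simp
      have "{r\<in>R. r < s} \<subseteq> {r\<in>R. r < t}" using that by auto
      moreover have "card {r\<in>R. r < s} = card {r\<in>R. r < t}" using that by (simp add: J_def)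
      ultimately have eq: "{r\<in>R. r < s} = {r\<in>R. r < t}" using card_subset_eq fin by blast
      \<comment> \<open>Equal counts together with inclusion force equal sets, so no element of
        \<open>R\<close> lies between \<open>s\<close> and \<open>t\<close>.\<close>
      have below: "r < s" if "r \<in> R" "r < t" for r using eq that by blast
      have "{r\<in>R. r < u} = {r\<in>R. r < s}"
        using below that(3,4) by (intro Collect_cong) fastforce
      moreover have "u \<notin> R"
      proof
        assume "u \<in> R"
        moreover have "u \<noteq> t" using \<open>u \<in> R\<close> that by (auto simp: J_def)
        ultimately have "u < s" using below that(4) by simp
        then show False using that(3) by simp
      qed
      moreover have "u \<in> I"
        using I that by (auto simp: J_def is_interval_1)
      ultimately show ?thesis using that by (simp add: J_def)
    qed
    then have "is_interval (J j)" unfolding is_interval_1 by blast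
    then show ?thesis by (rule is_interval_connected)
  qed
  have "card {r\<in>R. r < t} \<le> card R" for t using R by (simp add: card_mono)
  then show "(\<Union>j\<le>card R. J j) = I - R" by (auto simp: J_def)
qed

section \<open>Real roots of the determinant of a skew-symmetric pencil\<close>

lemma card_roots_nonneg_poly:
  fixes p :: "real poly"
  assumes "p \<noteq> 0" and nonneg: "\<And>x. 0 \<le> poly p x"
  shows "2 * card {x. poly p x = 0} \<le> degree p"
proof -
  \<comment> \<open>A root is a minimum of a nonnegative polynomial, so the derivative vanishes
    there too.\<close>
  have "2 \<le> order a p" if a: "poly p a = 0" for a
  proof -
    have "poly (pderiv p) a = 0"
      by (rule DERIV_local_min[OF poly_DERIV, of 1]) (use nonneg a in auto)
    \<comment> \<open>A root of the derivative has positive order only if the derivative is not the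
      zero polynomial.\<close>
    moreover have "pderiv p \<noteq> 0"
    proof
      assume "pderiv p = 0"
      then obtain c where "p = [:c:]" using degree_eq_zeroE by (auto simp: pderiv_eq_0_iff)
      then show False using a \<open>p \<noteq> 0\<close> by simp
    qed
    ultimately have "order a (pderiv p) \<noteq> 0" by (simp add: order_root)
    then show ?thesis using order_pderiv[OF \<open>p \<noteq> 0\<close> a] by simp
  qed
  then have "(\<Sum>x | poly p x = 0. 2) \<le> (\<Sum>x | poly p x = 0. order x p)"
    by (intro sum_mono) simp
  also have "\<dots> \<le> degree p" using \<open>p \<noteq> 0\<close> by (rule sum_order_le_degree)
  finally show ?thesis by simp
qed

text \<open>Each term of the Leibniz expansion is a product of \<open>CARD('n)\<close> entries, all
  of degree at most one in \<open>t\<close>.\<close>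

lemma det_affine_pencil_poly:
  fixes A B :: "real^'n^'n"
  obtains p where "degree p \<le> CARD('n)"
    and "\<And>t. det ((1 - t) *\<^sub>R A + t *\<^sub>R B) = poly p t"
proof
  define c where "c i j = [:A$i$j, B$i$j - A$i$j:]" for i j
  define p where "p = (\<Sum>\<pi> | \<pi> permutes (UNIV::'n set). smult (of_int (sign \<pi>)) (\<Prod>i\<in>UNIV. c i (\<pi> i)))"
  show "degree p \<le> CARD('n)" unfolding p_def
  proof (rule degree_sum_le)
    fix \<pi> :: "'n \<Rightarrow> 'n"
    have "degree (\<Prod>i\<in>UNIV. c i (\<pi> i)) \<le> (\<Sum>i\<in>(UNIV::'n set). degree (c i (\<pi> i)))"
      using degree_prod_sum_le[of UNIV "\<lambda>i. c i (\<pi> i)"] by (simp add: o_def)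
    also have "\<dots> \<le> (\<Sum>i\<in>(UNIV::'n set). 1)" by (rule sum_mono) (simp add: c_def)
    finally have "degree (\<Prod>i\<in>UNIV. c i (\<pi> i)) \<le> CARD('n)" by simp
    then show "degree (smult (of_int (sign \<pi>)) (\<Prod>i\<in>UNIV. c i (\<pi> i))) \<le> CARD('n)"
      using degree_smult_le order_trans by blast
  qed (simp add: finite_permutations)
  show "det ((1 - t) *\<^sub>R A + t *\<^sub>R B) = poly p t" for t
    unfolding p_def det_def poly_sum poly_smult poly_prod c_def
    by (simp add: algebra_simps)
qed

lemma continuous_on_det:
  fixes f :: "'a::topological_space \<Rightarrow> real^'n^'n"
  assumes "\<And>i j. continuous_on S (\<lambda>t. f t $ i $ j)"
  shows "continuous_on S (\<lambda>t. det (f t))"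
  unfolding det_def by (intro continuous_intros assms)

lemma skew_symmetric_inner_eq_0:
  fixes A :: "real^'n^'n"
  assumes "skew_symmetric A"
  shows "x \<bullet> (A *v x) = 0"
proof -
  have "x \<bullet> (A *v x) = (transpose A *v x) \<bullet> x"
    by (metis dot_lmul_matrix transpose_matrix_vector)
  also have "\<dots> = - (x \<bullet> (A *v x))"
    using assms by (simp add: skew_symmetric_def inner_commute matrix_vector_mult_def inner_vec_def sum_negf)
  finally show ?thesis by simp
qed

text \<open>
  Along the segment from the identity matrix to \<open>A\<close> the determinant does not vanish before \<open>A\<close>
  is reached, because \<open>A\<close> contributes nothing to the quadratic form.
\<close>

lemma det_skew_symmetric_nonneg:
  fixes A :: "real^'n^'n"
  assumes A: "skew_symmetric A"
  shows "0 \<le> det A"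
proof (rule ccontr)
  define f where "f s = det ((1 - s) *\<^sub>R mat 1 + s *\<^sub>R A)" for s :: real
  assume "\<not> 0 \<le> det A"
  then have "f 1 \<le> 0" by (simp add: f_def)
  moreover have "0 \<le> f 0" by (simp add: f_def)
  moreover have "continuous_on {0..1} f"
    unfolding f_def by (intro continuous_on_det) (simp, intro continuous_intros)
  ultimately obtain s where s: "0 \<le> s" "s \<le> 1" "f s = 0"
    using IVT2'[of f 1 0 0] by auto
  have "s \<noteq> 1" using s \<open>\<not> 0 \<le> det A\<close> by (auto simp: f_def)
  have "\<not> invertible ((1 - s) *\<^sub>R mat 1 + s *\<^sub>R A)" (is "\<not> invertible ?B")
    using s by (simp add: f_def invertible_det_nz)
  then obtain x where x: "x \<noteq> 0" "?B *v x = 0"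
    by (metis invertible_left_inverse matrix_left_invertible_ker)
  have "0 = x \<bullet> (?B *v x)" using x by simp
  also have "\<dots> = (1 - s) * (x \<bullet> x)"
    by (simp add: matrix_vector_mult_add_rdistrib scaleR_matrix_vector_assoc[symmetric]
        inner_add_right skew_symmetric_inner_eq_0[OF A])
  finally show False using x \<open>s \<noteq> 1\<close> by simp
qed

text \<open>Every matrix of the pencil is skew-symmetric, so the determinant is a nonnegative
  polynomial on the whole real line; \<open>t0\<close> only certifies that it is not zero. Its roots
  are counted on all of the line, not just in the parameter interval.\<close>

lemma card_singular_skew_pencil:
  fixes A B :: "real^'n^'n"
  assumes "skew_symmetric A" "skew_symmetric B"
    and "det ((1 - t0) *\<^sub>R A + t0 *\<^sub>R B) \<noteq> 0"
  shows "finite {t. det ((1 - t) *\<^sub>R A + t *\<^sub>R B) = 0}"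
    and "2 * card {t. det ((1 - t) *\<^sub>R A + t *\<^sub>R B) = 0} \<le> CARD('n)"
proof -
  obtain p where p: "degree p \<le> CARD('n)" "\<And>t. det ((1 - t) *\<^sub>R A + t *\<^sub>R B) = poly p t"
    using det_affine_pencil_poly[of A B] by blast
  have skew: "skew_symmetric ((1 - t) *\<^sub>R A + t *\<^sub>R B)" for t
  proof -
    have "transpose ((1 - t) *\<^sub>R A + t *\<^sub>R B) = (1 - t) *\<^sub>R transpose A + t *\<^sub>R transpose B"
      by (simp add: transpose_def vec_eq_iff)
    then show ?thesis using assms(1,2) by (simp add: skew_symmetric_def)
  qed
  have "p \<noteq> 0" using assms(3) p(2)[of t0] by auto
  then show "finite {t. det ((1 - t) *\<^sub>R A + t *\<^sub>R B) = 0}"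
    using poly_roots_finite by (simp add: p)
  show "2 * card {t. det ((1 - t) *\<^sub>R A + t *\<^sub>R B) = 0} \<le> CARD('n)"
    using card_roots_nonneg_poly[OF \<open>p \<noteq> 0\<close>] det_skew_symmetric_nonneg[OF skew] p
    by (metis (no_types, lifting) Collect_cong order_trans)
qed

section \<open>Components of the solution set of a parametric linear system\<close>

lemma num_components_parametric_linear_system:
  fixes A :: "real \<Rightarrow> real^'n^'n" and b :: "real \<Rightarrow> real^'n"
  assumes I: "is_interval I"
    and A: "\<And>i j. continuous_on I (\<lambda>t. A t $ i $ j)" and b: "\<And>i. continuous_on I (\<lambda>t. b t $ i)"
    and fin: "finite {t. det (A t) = 0}"
  shows "num_components {x. \<exists>t\<in>I. A t *v x = b t} \<le> enat (2 * card {t. det (A t) = 0} + 1)"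
proof -
  define R where "R = {t. det (A t) = 0}"
  define X where "X t = {x. A t *v x = b t}" for t
  \<comment> \<open>Cramer's rule makes the unique solution at a regular parameter explicit, so its
    continuity follows from that of determinants.\<close>
  define g where
    "g t = (\<chi> k. det (\<chi> i j. if j = k then b t $ i else A t $ i $ j) / det (A t))" for t
  have finR: "finite R" using fin by (simp add: R_def)
  obtain J where J: "\<And>j. connected (J j)" and UJ: "(\<Union>j\<le>card R. J j) = I - R"
    using interval_minus_finite_cover[OF I finR] by blast
  have Xg: "X t = {g t}" if "t \<notin> R" for t
    using that by (auto simp: X_def g_def R_def cramer)
  have "continuous_on (I - R) (\<lambda>t. det (\<chi> i j. if j = k then b t $ i else A t $ i $ j))" for k
  proof (rule continuous_on_det)
    show "continuous_on (I - R) (\<lambda>t. (\<chi> i j. if j = k then b t $ i else A t $ i $ j) $ i $ j)" for i j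
      using A[of i j] b[of i] by (cases "j = k") (auto intro: continuous_on_subset)
  qed
  moreover have "continuous_on (I - R) (\<lambda>t. det (A t))"
    using A by (intro continuous_on_det) (auto intro: continuous_on_subset)
  ultimately have g: "continuous_on (I - R) g"
    unfolding g_def by (intro continuous_on_vec_lambda continuous_on_divide) (auto simp: R_def)
  \<comment> \<open>At most \<open>card R\<close> affine solution sets from singular parameters and
    at most \<open>card R + 1\<close> continuous images from regular ones. An inconsistent singular
    system contributes the empty set, which is connected as well.\<close>
  define \<C> where "\<C> = X ` (R \<inter> I) \<union> (\<lambda>j. g ` J j) ` {..card R}"
  have "connected (X t)" for t
  proof -
    have "convex (X t)"
      unfolding X_def convex_def
      by (auto simp: matrix_vector_right_distrib matrix_vector_mult_scaleR
          simp flip: scaleR_add_left)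
    then show ?thesis by (rule convex_connected)
  qed
  moreover have "connected (g ` J j)" if "j \<le> card R" for j
    using that UJ by (intro connected_continuous_image J continuous_on_subset[OF g]) blast
  ultimately have con: "\<And>C. C \<in> \<C> \<Longrightarrow> connected C" by (auto simp: \<C>_def)
  have finC: "finite \<C>" using finR by (simp add: \<C>_def)
  have "\<Union>\<C> = (\<Union>t\<in>R \<inter> I. X t) \<union> g ` (\<Union>j\<le>card R. J j)" by (auto simp: \<C>_def)
  also have "\<dots> = (\<Union>t\<in>I. X t)" unfolding UJ using Xg by auto
  also have "\<dots> = {x. \<exists>t\<in>I. A t *v x = b t}" by (auto simp: X_def)
  finally have cov: "\<Union>\<C> = {x. \<exists>t\<in>I. A t *v x = b t}" .
  have "card \<C> \<le> card (X ` (R \<inter> I)) + card ((\<lambda>j. g ` J j) ` {..card R})"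
    unfolding \<C>_def by (rule card_Un_le)
  also have "\<dots> \<le> card (R \<inter> I) + card {..card R}"
    using finR by (intro add_mono card_image_le) auto
  also have "\<dots> \<le> 2 * card R + 1"
    using card_mono[OF finR, of "R \<inter> I"] by simp
  finally have "card \<C> \<le> 2 * card R + 1" .
  then show ?thesis
    using card_components_le_cover[OF finC con cov] by (simp add: num_components_def R_def)
qed

section \<open>Theorems of the alternative for two vectors\<close>

lemma gordan_two:
  fixes a b :: "'a::euclidean_space"
  shows "(\<forall>u. \<not> (0 < a \<bullet> u \<and> 0 < b \<bullet> u)) \<longleftrightarrow> (\<exists>t\<in>{0..1}. (1 - t) *\<^sub>R a + t *\<^sub>R b = 0)"
proof
  assume *: "\<forall>u. \<not> (0 < a \<bullet> u \<and> 0 < b \<bullet> u)"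
  \<comment> \<open>Otherwise a hyperplane strictly separates 0 from the compact segment, and its
    normal \<open>u\<close> is positive on both endpoints.\<close>
  have "0 \<in> closed_segment a b"
  proof (rule ccontr)
    assume "0 \<notin> closed_segment a b"
    then obtain u c where "0 < c" "\<forall>x\<in>closed_segment a b. c < u \<bullet> x"
      using separating_hyperplane_closed_0[of "closed_segment a b"] by auto
    then have "0 < a \<bullet> u" "0 < b \<bullet> u"
      by (metis ends_in_segment inner_commute order.strict_trans)+
    then show False using * by blast
  qed
  then show "\<exists>t\<in>{0..1}. (1 - t) *\<^sub>R a + t *\<^sub>R b = 0" by (auto simp: in_segment)
next
  assume "\<exists>t\<in>{0..1}. (1 - t) *\<^sub>R a + t *\<^sub>R b = 0"
  then obtain t where t: "0 \<le> t" "t \<le> 1" "(1 - t) *\<^sub>R a + t *\<^sub>R b = 0" by auto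
  show "\<forall>u. \<not> (0 < a \<bullet> u \<and> 0 < b \<bullet> u)"
  proof (intro allI notI)
    fix u assume u: "0 < a \<bullet> u \<and> 0 < b \<bullet> u"
    have "(1 - t) * (a \<bullet> u) + t * (b \<bullet> u) = 0"
      using arg_cong[OF t(3), of "\<lambda>v. v \<bullet> u"] by (simp add: inner_add_left)
    moreover have "0 < (1 - t) * (a \<bullet> u) + t * (b \<bullet> u)"
    proof (cases "t = 0")
      case False
      then show ?thesis using t u by (intro add_nonneg_pos) auto
    qed (use u in simp)
    ultimately show False by simp
  qed
qed

lemma stiemke_two:
  fixes a b :: "'a::euclidean_space"
  shows "(\<forall>u. \<not> (0 \<le> a \<bullet> u \<and> 0 \<le> b \<bullet> u \<and> \<not> (a \<bullet> u = 0 \<and> b \<bullet> u = 0)))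
    \<longleftrightarrow> (\<exists>t\<in>{0<..<1}. (1 - t) *\<^sub>R a + t *\<^sub>R b = 0)"
proof
  assume *: "\<forall>u. \<not> (0 \<le> a \<bullet> u \<and> 0 \<le> b \<bullet> u \<and> \<not> (a \<bullet> u = 0 \<and> b \<bullet> u = 0))"
  show "\<exists>t\<in>{0<..<1}. (1 - t) *\<^sub>R a + t *\<^sub>R b = 0"
  proof (cases "a = 0 \<or> b = 0")
    case True
    \<comment> \<open>If one vector vanishes, testing with \<open>u\<close> equal to the other one
      shows that it vanishes too; then every \<open>t\<close> works, for instance 1/2.\<close>
    then have "a = 0 \<and> b = 0" using *[rule_format, of a] *[rule_format, of b] by auto
    then show ?thesis by (intro bexI[of _ "1/2"]) auto
  next
    case False
    have "\<forall>u. \<not> (0 < a \<bullet> u \<and> 0 < b \<bullet> u)" using * by (metis less_imp_le less_irrefl)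
    then obtain t where t: "t \<in> {0..1}" "(1 - t) *\<^sub>R a + t *\<^sub>R b = 0"
      using gordan_two[of a b] by blast
    \<comment> \<open>At an endpoint the combination is \<open>a\<close> or \<open>b\<close> itself,
      and both are nonzero here.\<close>
    then have "t \<noteq> 0" "t \<noteq> 1" using False by auto
    then show ?thesis using t by (intro bexI[of _ t]) auto
  qed
next
  assume "\<exists>t\<in>{0<..<1}. (1 - t) *\<^sub>R a + t *\<^sub>R b = 0"
  then obtain t where t: "0 < t" "t < 1" "(1 - t) *\<^sub>R a + t *\<^sub>R b = 0" by auto
  show "\<forall>u. \<not> (0 \<le> a \<bullet> u \<and> 0 \<le> b \<bullet> u \<and> \<not> (a \<bullet> u = 0 \<and> b \<bullet> u = 0))"
  proof (intro allI notI)
    fix u assume u: "0 \<le> a \<bullet> u \<and> 0 \<le> b \<bullet> u \<and> \<not> (a \<bullet> u = 0 \<and> b \<bullet> u = 0)"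
    have "(1 - t) * (a \<bullet> u) + t * (b \<bullet> u) = 0"
      using arg_cong[OF t(3), of "\<lambda>v. v \<bullet> u"] by (simp add: inner_add_left)
    moreover have "0 \<le> (1 - t) * (a \<bullet> u)" "0 \<le> t * (b \<bullet> u)" using t u by auto
    ultimately have "(1 - t) * (a \<bullet> u) = 0" "t * (b \<bullet> u) = 0" by linarith+
    then show False using t u by auto
  qed
qed

section \<open>Scalarization of the bicriteria problem\<close>

lemma interior_nonneg_orthant:
  "interior (nonneg_orthant :: (real^'m::finite) set) = {z. \<forall>i. 0 < z $ i}"
proof (rule interior_unique)
  show "{z :: real^'m. \<forall>i. 0 < z $ i} \<subseteq> nonneg_orthant"
    by (auto simp: nonneg_orthant_def less_imp_le)
  show "open {z :: real^'m. \<forall>i. 0 < z $ i}"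
    unfolding Collect_all_eq by (intro open_INT ballI open_Collect_less continuous_intros) simp
  fix T :: "(real^'m) set" assume T: "T \<subseteq> nonneg_orthant" "open T"
  show "T \<subseteq> {z. \<forall>i. 0 < z $ i}"
  proof (intro subsetI CollectI allI)
    fix z i assume "z \<in> T"
    have "T \<subseteq> {z. 0 \<le> z $ i}" using T by (auto simp: nonneg_orthant_def)
    then have "T \<subseteq> interior {z. 0 \<le> z $ i}" using T(2) by (rule interior_maximal)
    then show "0 < z $ i" using \<open>z \<in> T\<close> by auto
  qed
qed

lemma pencil_operator_eq_0_iff:
  "(1 - t) *\<^sub>R affine_op A a x + t *\<^sub>R affine_op B b x = 0
    \<longleftrightarrow> ((1 - t) *\<^sub>R A + t *\<^sub>R B) *v x = - ((1 - t) *\<^sub>R a + t *\<^sub>R b)"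
  by (simp add: affine_op_def scaleR_matrix_vector_assoc[symmetric]
      eq_neg_iff_add_eq_0 algebra_simps)

text \<open>Since the constraint set is the whole space, the differences \<open>x - y\<close> in the
  solution concepts can be replaced by arbitrary directions \<open>u\<close>.\<close>

lemma all_diff_iff: "(\<forall>y. P (x - y)) \<longleftrightarrow> (\<forall>u. P u)" for x :: "'a::group_add"
  by (metis diff_diff_eq2 minus_diff_eq diff_minus_eq_add diff_add_cancel)

lemma Sol_weak_bicriteria:
  fixes M :: "2 \<Rightarrow> real^'n^'n"
  shows "Sol_weak UNIV M q = {x. \<exists>t\<in>{0..1}.
    ((1 - t) *\<^sub>R M 1 + t *\<^sub>R M 2) *v x = - ((1 - t) *\<^sub>R q 1 + t *\<^sub>R q 2)}"
proof -
  have "x \<in> Sol_weak UNIV M q \<longleftrightarrow>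
    (\<forall>u. \<not> (0 < affine_op (M 1) (q 1) x \<bullet> u \<and> 0 < affine_op (M 2) (q 2) x \<bullet> u))" for x
    using all_diff_iff[of "\<lambda>u. vector_op M q x u \<notin> interior nonneg_orthant" x]
    by (simp add: Sol_weak_def interior_nonneg_orthant vector_op_def forall_2)
  then show ?thesis unfolding gordan_two pencil_operator_eq_0_iff by blast
qed

text \<open>Excluding only the zero vector from the orthant gives the alternative of Stiemke instead
  of Gordan, hence strictly positive weights and an open interval.\<close>

lemma Sol_bicriteria:
  fixes M :: "2 \<Rightarrow> real^'n^'n"
  shows "Sol UNIV M q = {x. \<exists>t\<in>{0<..<1}.
    ((1 - t) *\<^sub>R M 1 + t *\<^sub>R M 2) *v x = - ((1 - t) *\<^sub>R q 1 + t *\<^sub>R q 2)}"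
proof -
  have "x \<in> Sol UNIV M q \<longleftrightarrow>
    (\<forall>u. \<not> (0 \<le> affine_op (M 1) (q 1) x \<bullet> u \<and> 0 \<le> affine_op (M 2) (q 2) x \<bullet> u \<and>
      \<not> (affine_op (M 1) (q 1) x \<bullet> u = 0 \<and> affine_op (M 2) (q 2) x \<bullet> u = 0)))" for x
    using all_diff_iff[of "\<lambda>u. vector_op M q x u \<notin> nonneg_orthant - {0}" x]
    by (simp add: Sol_def nonneg_orthant_def vector_op_def vec_eq_iff forall_2)
  then show ?thesis unfolding stiemke_two pencil_operator_eq_0_iff by blast
qed

theorem theorem3p1:
  fixes M :: "2 \<Rightarrow> real^'n^'n" and q :: "2 \<Rightarrow> real^'n"
  assumes "CARD('n) \<ge> 2" and "even CARD('n)"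
    and "\<forall>i. skew_symmetric (M i)"
    and "nondegenerate M"
  shows "max (num_components (Sol UNIV M q)) (num_components (Sol_weak UNIV M q))
           \<le> enat (CARD('n) + 1)"
proof -
  define A where "A t = (1 - t) *\<^sub>R M 1 + t *\<^sub>R M 2" for t
  define b where "b t = - ((1 - t) *\<^sub>R q 1 + t *\<^sub>R q 2)" for t
  obtain \<xi> :: "real^2" where "\<xi> \<in> unit_simplex" and det: "det (\<Sum>i\<in>UNIV. \<xi> $ i *\<^sub>R M i) \<noteq> 0"
    using assms(4) by (auto simp: nondegenerate_def)
  \<comment> \<open>The second weight of the nondegeneracy witness is the regular pencil parameter
    \<open>t0\<close>.\<close>
  then have "\<xi> $ 1 = 1 - \<xi> $ 2" by (simp add: unit_simplex_def sum_2)
  with det have "det ((1 - \<xi> $ 2) *\<^sub>R M 1 + \<xi> $ 2 *\<^sub>R M 2) \<noteq> 0" by (simp add: sum_2)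
  note sing = card_singular_skew_pencil[OF assms(3)[rule_format] assms(3)[rule_format] this,
      folded A_def]
  \<comment> \<open>One bound serves the open and the closed interval, because the singular
    parameters are counted independently of \<open>I\<close>.\<close>
  have bound: "num_components {x. \<exists>t\<in>I. A t *v x = b t} \<le> enat (CARD('n) + 1)"
    if "is_interval I" for I
  proof -
    have "num_components {x. \<exists>t\<in>I. A t *v x = b t} \<le> enat (2 * card {t. det (A t) = 0} + 1)"
    proof (rule num_components_parametric_linear_system[OF that _ _ sing(1)])
      show "continuous_on I (\<lambda>t. A t $ i $ j)" for i j
        by (simp add: A_def) (intro continuous_intros)
      show "continuous_on I (\<lambda>t. b t $ i)" for i
        by (simp add: b_def) (intro continuous_intros)
    qed
    also have "\<dots> \<le> enat (CARD('n) + 1)" using sing(2) by simp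
    finally show ?thesis .
  qed
  show ?thesis
    unfolding Sol_bicriteria Sol_weak_bicriteria A_def[symmetric] b_def[symmetric]
    using bound[of "{0<..<1}"] bound[of "{0..1}"] by (simp add: is_interval_1)
qed

end
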